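(* Let $G=\mathbb{Z}^2\rtimes\mathbb{Z}_2=\langle a,b,t\mid [a,b]=1,\ t^2=1,\ tat=b\rangle$, and let $A=\{a,a^{-1},t\}$ (where $t^{-1}=t$ in $G$) be the inverse-closed generating set determined by $\{a,t\}$. Then $G$ has a length non-increasing synchronously regular convergent prefix-rewriting system over the alphabet $A$, but the pair $(G,A)$ does not have the falsification by fellow traveler property.
   Context: $A^*$ is the set of words over $A$; $|u|$ is the length of $u$; $u(n)$ is the prefix of $u$ of length $n$ (and $u(n)=u$ if $n\ge|u|$); $u=_Gv$ means $u$ and $v$ represent the same element of $G$; $d_{G,A}$ is the path metric on the Cayley graph of $G$ with respect to $A$. Falsification by fellow traveler property: $(G,A)$ has it if there is a constant $k$ such that for each non-geodesic word $u\in A^*$ there is a word $v\in A^*$ with $|v|<|u|$, $u=_Gv$, and $d_{G,A}(u(n),v(n))\le k$ for all $n\in\mathbb{N}$ (words being identified with the group elements they represent). Synchronous regularity: a set $R\subseteq A^*\times A^*$ is synchronously regular if the set of padded pairs is a regular language, where a pair $(u,v)\in R$ is padded by appending a padding symbol $\$\notin A$ to the end of the shorter word until both have length $\max(|u|,|v|)$, and the result is regarded as a word over $(A\cup\{\$\})\times(A\cup\{\$\})$. Convergent prefix-rewriting system for $G$ over $A$: a set $R\subseteq A^*\times A^*$ such that $G$ is presented as a monoid by $\mathrm{Mon}\langle A\mid \{u=v : (u,v)\in R\}\rangle$, and the rewritings $uw\to_R vw$ (for $(u,v)\in R$, $w\in A^*$) satisfy: there is no infinite chain $w_1\to_R w_2\to_R\cdots$,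 and each element of $G$ is represented by exactly one irreducible word (a word that cannot be rewritten). $R$ is length non-increasing if $|v|\le|u|$ for every $(u,v)\in R$. *)

theory Defs
  imports "HOL-Algebra.Elementary_Groups"
begin

section \<open>Words over a subset of a group\<close>

text \<open>The alphabet \<open>A\<close> is a subset of the carrier of \<open>G\<close>, so letters are group elements and the set
  of words is \<^term>\<open>lists A\<close>. In particular an involution and its inverse are one and the same letter.\<close>

definition word_val :: "('a, 'm) monoid_scheme \<Rightarrow> 'a list \<Rightarrow> 'a" where
  "word_val G w = foldr (\<otimes>\<^bsub>G\<^esub>) w \<one>\<^bsub>G\<^esub>"

definition cayley_edges :: "('a, 'm) monoid_scheme \<Rightarrow> 'a set \<Rightarrow> 'a rel" where
  "cayley_edges G A = {(g, g \<otimes>\<^bsub>G\<^esub> s) | g s. g \<in> carrier G \<and> s \<in> A}"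

text \<open>Only meaningful when \<open>A\<close> is an inverse-closed generating set (otherwise the edge relation is
  not symmetric, or there may be no path from \<open>g\<close> to \<open>h\<close>).\<close>

definition cayley_dist :: "('a, 'm) monoid_scheme \<Rightarrow> 'a set \<Rightarrow> 'a \<Rightarrow> 'a \<Rightarrow> nat" where
  "cayley_dist G A g h = (LEAST n. (g, h) \<in> cayley_edges G A ^^ n)"

definition geodesic_word :: "('a, 'm) monoid_scheme \<Rightarrow> 'a set \<Rightarrow> 'a list \<Rightarrow> bool" where
  "geodesic_word G A w \<longleftrightarrow> length w = cayley_dist G A \<one>\<^bsub>G\<^esub> (word_val G w)"

definition falsification_by_fellow_traveler :: "('a, 'm) monoid_scheme \<Rightarrow> 'a set \<Rightarrow> bool" where
  "falsification_by_fellow_traveler G A \<longleftrightarrow>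
     (\<exists>k. \<forall>u \<in> lists A. \<not> geodesic_word G A u \<longrightarrow>
       (\<exists>v \<in> lists A. length v < length u \<and> word_val G u = word_val G v \<and>
          (\<forall>n. cayley_dist G A (word_val G (take n u)) (word_val G (take n v)) \<le> k)))"


section \<open>Regular languages and synchronous regularity\<close>

text \<open>Acceptance by a complete deterministic finite automaton. Taking the states to be natural numbers
  loses no generality since the state set \<open>Q\<close> is finite.\<close>

definition regular_language :: "'s set \<Rightarrow> 's list set \<Rightarrow> bool" where
  "regular_language S L \<longleftrightarrow>
     (\<exists>(Q :: nat set) q0 F \<delta>. finite Q \<and> q0 \<in> Q \<and> F \<subseteq> Q \<and> (\<forall>q \<in> Q. \<forall>s \<in> S. \<delta> q s \<in> Q) \<and>
        L = {w \<in> lists S. foldl \<delta> q0 w \<in> F})"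

text \<open>The padding symbol is \<^term>\<open>None\<close>.\<close>

definition pad :: "'a list \<times> 'a list \<Rightarrow> ('a option \<times> 'a option) list" where
  "pad = (\<lambda>(u, v). zip (map Some u @ replicate (length v - length u) None)
                        (map Some v @ replicate (length u - length v) None))"

definition padded_alphabet :: "'a set \<Rightarrow> ('a option \<times> 'a option) set" where
  "padded_alphabet A = insert None (Some ` A) \<times> insert None (Some ` A)"

definition synchronously_regular :: "'a set \<Rightarrow> ('a list \<times> 'a list) set \<Rightarrow> bool" where
  "synchronously_regular A R \<longleftrightarrow> R \<subseteq> lists A \<times> lists A \<and> regular_language (padded_alphabet A) (pad ` R)"


section \<open>Monoid presentations and prefix-rewriting\<close>

text \<open>The congruence on the free monoid \<^term>\<open>lists A\<close> generated by \<open>R\<close>.\<close>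

inductive_set monoid_cong :: "'a set \<Rightarrow> ('a list \<times> 'a list) set \<Rightarrow> ('a list \<times> 'a list) set"
  for A :: "'a set" and R :: "('a list \<times> 'a list) set" where
  rel: "(u, v) \<in> R \<Longrightarrow> x \<in> lists A \<Longrightarrow> y \<in> lists A \<Longrightarrow> (x @ u @ y, x @ v @ y) \<in> monoid_cong A R"
| refl: "u \<in> lists A \<Longrightarrow> (u, u) \<in> monoid_cong A R"
| sym: "(u, v) \<in> monoid_cong A R \<Longrightarrow> (v, u) \<in> monoid_cong A R"
| trans: "(u, v) \<in> monoid_cong A R \<Longrightarrow> (v, w) \<in> monoid_cong A R \<Longrightarrow> (u, w) \<in> monoid_cong A R"

text \<open>Evaluation of words induces an isomorphism from the quotient of the free monoid by the
  congruence onto \<open>G\<close>.\<close>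

definition monoid_presentation ::
    "('a, 'm) monoid_scheme \<Rightarrow> 'a set \<Rightarrow> ('a list \<times> 'a list) set \<Rightarrow> bool" where
  "monoid_presentation G A R \<longleftrightarrow>
     word_val G ` lists A = carrier G \<and>
     (\<forall>u \<in> lists A. \<forall>v \<in> lists A. word_val G u = word_val G v \<longleftrightarrow> (u, v) \<in> monoid_cong A R)"

definition prefix_step :: "'a set \<Rightarrow> ('a list \<times> 'a list) set \<Rightarrow> 'a list rel" where
  "prefix_step A R = {(u @ w, v @ w) | u v w. (u, v) \<in> R \<and> w \<in> lists A}"

definition irreducible_word :: "'a set \<Rightarrow> ('a list \<times> 'a list) set \<Rightarrow> 'a list \<Rightarrow> bool" where
  "irreducible_word A R w \<longleftrightarrow> w \<in> lists A \<and> (\<nexists>w'. (w, w') \<in> prefix_step A R)"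

definition convergent_prefix_rewriting_system ::
    "('a, 'm) monoid_scheme \<Rightarrow> 'a set \<Rightarrow> ('a list \<times> 'a list) set \<Rightarrow> bool" where
  "convergent_prefix_rewriting_system G A R \<longleftrightarrow>
     R \<subseteq> lists A \<times> lists A \<and>
     monoid_presentation G A R \<and>
     (\<nexists>w :: nat \<Rightarrow> 'a list. \<forall>i. (w i, w (Suc i)) \<in> prefix_step A R) \<and>
     (\<forall>g \<in> carrier G. \<exists>!w. irreducible_word A R w \<and> word_val G w = g)"

definition length_nonincreasing :: "('a list \<times> 'a list) set \<Rightarrow> bool" where
  "length_nonincreasing R \<longleftrightarrow> (\<forall>(u, v) \<in> R. length v \<le> length u)"


section \<open>The group\<close>

definition semidirect_product ::
    "('a, 'm) monoid_scheme \<Rightarrow> ('b, 'n) monoid_scheme \<Rightarrow> ('b \<Rightarrow> 'a \<Rightarrow> 'a) \<Rightarrow> ('a \<times> 'b) monoid" where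
  "semidirect_product N H \<phi> =
     \<lparr>carrier = carrier N \<times> carrier H,
      monoid.mult = (\<lambda>(x, h) (y, k). (x \<otimes>\<^bsub>N\<^esub> \<phi> h y, h \<otimes>\<^bsub>H\<^esub> k)),
      one = (\<one>\<^bsub>N\<^esub>, \<one>\<^bsub>H\<^esub>)\<rparr>"

definition swap_action :: "int \<Rightarrow> int \<times> int \<Rightarrow> int \<times> int" where
  "swap_action h = (if h = 0 then id else prod.swap)"

definition swap_group :: "((int \<times> int) \<times> int) monoid" where
  "swap_group = semidirect_product (integer_group \<times>\<times> integer_group) (integer_mod_group 2) swap_action"

definition gen_a :: "(int \<times> int) \<times> int" where "gen_a = ((1, 0), 0)"
definition gen_b :: "(int \<times> int) \<times> int" where "gen_b = ((0, 1), 0)"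
definition gen_t :: "(int \<times> int) \<times> int" where "gen_t = ((0, 0), 1)"

definition swap_group_gens :: "((int \<times> int) \<times> int) set" where
  "swap_group_gens = {gen_a, inv\<^bsub>swap_group\<^esub> gen_a, gen_t}"

lemma carrier_swap_group: "carrier swap_group = UNIV \<times> {0, 1}"
  by (auto simp: swap_group_def semidirect_product_def carrier_integer_mod_group)

lemma one_swap_group: "\<one>\<^bsub>swap_group\<^esub> = ((0, 0), 0)"
  by (simp add: swap_group_def semidirect_product_def)

lemma mult_swap_group:
  "((m, n), e) \<otimes>\<^bsub>swap_group\<^esub> ((m', n'), e') =
     ((if e = 0 then (m + m', n + n') else (m + n', n + m')), (e + e') mod 2)"
  by (simp add: swap_group_def semidirect_product_def swap_action_def)

lemma group_swap_group: "group swap_group"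
proof (rule groupI)
  fix x assume "x \<in> carrier swap_group"
  then obtain m n e where x: "x = ((m, n), e)" "e = 0 \<or> e = 1"
    by (auto simp: carrier_swap_group)
  show "\<exists>y\<in>carrier swap_group. y \<otimes>\<^bsub>swap_group\<^esub> x = \<one>\<^bsub>swap_group\<^esub>"
    by (rule bexI[of _ "if e = 0 then ((-m, -n), 0) else ((-n, -m), 1)"])
       (use x in \<open>auto simp: carrier_swap_group mult_swap_group one_swap_group\<close>)
qed (auto simp: carrier_swap_group mult_swap_group one_swap_group)

lemma gens_in_carrier:
  "gen_a \<in> carrier swap_group" "gen_b \<in> carrier swap_group" "gen_t \<in> carrier swap_group"
  by (auto simp: carrier_swap_group gen_a_def gen_b_def gen_t_def)

lemma inv_gen_a: "inv\<^bsub>swap_group\<^esub> gen_a = ((-1, 0), 0)"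
  by (rule group.inv_equality[OF group_swap_group])
     (auto simp: gen_a_def carrier_swap_group mult_swap_group one_swap_group)

text \<open>The group is presented by \<open>\<langle>a, b, t | [a, b] = 1, t\<^sup>2 = 1, tat = b\<rangle>\<close>: the relations hold,
  \<open>a\<close>, \<open>b\<close>, \<open>t\<close> (indeed \<open>a\<close>, \<open>t\<close>) generate, and any three elements of a group satisfying
  the relations are the images of \<open>a\<close>, \<open>b\<close>, \<open>t\<close> under a homomorphism.\<close>

lemma swap_group_relations:
  "gen_a \<otimes>\<^bsub>swap_group\<^esub> gen_b = gen_b \<otimes>\<^bsub>swap_group\<^esub> gen_a"
  "gen_t \<otimes>\<^bsub>swap_group\<^esub> gen_t = \<one>\<^bsub>swap_group\<^esub>"
  "gen_t \<otimes>\<^bsub>swap_group\<^esub> gen_a \<otimes>\<^bsub>swap_group\<^esub> gen_t = gen_b"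
  by (simp_all add: gen_a_def gen_b_def gen_t_def mult_swap_group one_swap_group)

lemma swap_group_gens_inverse_closed:
  "swap_group_gens = {gen_a, gen_t} \<union> m_inv swap_group ` {gen_a, gen_t}"
proof -
  have "inv\<^bsub>swap_group\<^esub> gen_t = gen_t"
    by (rule group.inv_equality[OF group_swap_group swap_group_relations(2) gens_in_carrier(3,3)])
  then show ?thesis by (auto simp: swap_group_gens_def)
qed

lemma generate_swap_group: "generate swap_group {gen_a, gen_t} = carrier swap_group"
proof -
  interpret group swap_group by (rule group_swap_group)
  let ?S = "generate swap_group {gen_a, gen_t}"
  have S: "subgroup ?S swap_group"
    by (rule generate_is_subgroup) (use gens_in_carrier in auto)
  have a: "gen_a \<in> ?S" and t: "gen_t \<in> ?S" by (auto intro: generate.incl)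
  have b: "gen_b \<in> ?S"
    using a t generate.eng swap_group_relations(3) by metis
  have pow: "x [^]\<^bsub>swap_group\<^esub> (k :: int) \<in> ?S" if "x \<in> ?S" for x k
    using subgroup_int_pow_closed[OF S that] .
  have nat_pow_ab:
      "gen_a [^]\<^bsub>swap_group\<^esub> (k :: nat) = ((int k, 0), 0) \<and>
       gen_b [^]\<^bsub>swap_group\<^esub> k = ((0, int k), 0)" for k
    by (induction k) (auto simp: one_swap_group mult_swap_group gen_a_def gen_b_def)
  have inv0: "inv\<^bsub>swap_group\<^esub> ((m, n), 0) = ((-m, -n), 0)" for m n
    by (rule inv_equality) (auto simp: carrier_swap_group mult_swap_group one_swap_group)
  have pow_a: "gen_a [^]\<^bsub>swap_group\<^esub> (k :: int) = ((k, 0), 0)" for k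
    by (auto simp: int_pow_def2 nat_pow_ab inv0)
  have pow_b: "gen_b [^]\<^bsub>swap_group\<^esub> (k :: int) = ((0, k), 0)" for k
    by (auto simp: int_pow_def2 nat_pow_ab inv0)
  have "((m, n), e) \<in> ?S" if "e = 0 \<or> e = 1" for m n e
  proof -
    have *: "((m, n), 0) \<in> ?S"
      using generate.eng[OF pow[OF a, of m] pow[OF b, of n]]
      by (simp add: pow_a pow_b mult_swap_group)
    have "((m, n), 1) \<in> ?S"
      using generate.eng[OF * t] by (simp add: gen_t_def mult_swap_group)
    with * that show ?thesis by auto
  qed
  then have "carrier swap_group \<subseteq> ?S" by (auto simp: carrier_swap_group)
  moreover have "?S \<subseteq> carrier swap_group" by (rule subgroup.subset[OF S])
  ultimately show ?thesis by blast
qed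

lemma swap_group_universal:
  fixes H (structure)
  assumes "group H" and x: "x \<in> carrier H" and y: "y \<in> carrier H" and z: "z \<in> carrier H"
    and xy: "x \<otimes> y = y \<otimes> x" and zz: "z \<otimes> z = \<one>" and zxz: "z \<otimes> x \<otimes> z = y"
  shows "\<exists>h \<in> hom swap_group H. h gen_a = x \<and> h gen_b = y \<and> h gen_t = z"
proof -
  interpret group H by fact
  have zzg: "z \<otimes> (z \<otimes> g) = g" if "g \<in> carrier H" for g
    using that z zz by (simp flip: m_assoc)
  have conj: "(\<lambda>g. z \<otimes> g \<otimes> z) \<in> hom H H"
    using z zzg by (auto intro!: homI simp: m_assoc)
  have zyz: "z \<otimes> y \<otimes> z = x"
    using x z zz zzg by (simp add: zxz[symmetric] m_assoc)
  have "z \<otimes> x [^] k \<otimes> z = y [^] k" for k :: int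
    using hom_int_pow[OF conj x is_group is_group] zxz by simp
  then have zx: "z \<otimes> x [^] k = y [^] k \<otimes> z" for k :: int
    using x z zz by (metis int_pow_closed m_assoc m_closed r_one)
  have "z \<otimes> y [^] k \<otimes> z = x [^] k" for k :: int
    using hom_int_pow[OF conj y is_group is_group] zyz by simp
  then have zy: "z \<otimes> y [^] k = x [^] k \<otimes> z" for k :: int
    using y z zz by (metis int_pow_closed m_assoc m_closed r_one)
  have "y \<otimes> x [^] k = x [^] k \<otimes> y" for k :: int
  proof -
    have c: "(\<lambda>g. y \<otimes> g \<otimes> inv y) \<in> hom H H"
      using y by (auto intro!: homI simp: m_assoc inv_solve_left)
    have "y \<otimes> x \<otimes> inv y = x" using x y xy by (simp add: inv_solve_right')
    then have "y \<otimes> x [^] k \<otimes> inv y = x [^] k"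
      using hom_int_pow[OF c x is_group is_group] by simp
    then show ?thesis using x y by (metis int_pow_closed inv_closed inv_solve_right m_closed)
  qed
  note yxk = this
  have yx: "y [^] l \<otimes> x [^] k = x [^] k \<otimes> y [^] l" for k l :: int
  proof -
    have c: "(\<lambda>g. x [^] k \<otimes> g \<otimes> inv (x [^] k)) \<in> hom H H"
      using x by (auto intro!: homI simp: m_assoc inv_solve_left)
    have "x [^] k \<otimes> y \<otimes> inv (x [^] k) = y"
      using x y yxk[of k] by (simp add: inv_solve_right')
    then have "x [^] k \<otimes> y [^] l \<otimes> inv (x [^] k) = y [^] l"
      using hom_int_pow[OF c y is_group is_group] by simp
    then show ?thesis using x y by (metis int_pow_closed inv_closed inv_solve_right m_closed)
  qed
  have yxg: "y [^] l \<otimes> (x [^] k \<otimes> g) = x [^] k \<otimes> (y [^] l \<otimes> g)"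
    and zxg: "z \<otimes> (x [^] k \<otimes> g) = y [^] k \<otimes> (z \<otimes> g)"
    and zyg: "z \<otimes> (y [^] k \<otimes> g) = x [^] k \<otimes> (z \<otimes> g)" if "g \<in> carrier H" for g and k l :: int
    using that x y z yx[of l k] zx[of k] zy[of k] by (simp_all flip: m_assoc)
  let ?h = "\<lambda>((m :: int, n :: int), e :: int). x [^] m \<otimes> y [^] n \<otimes> (if e = 0 then \<one> else z)"
  have "?h \<in> hom swap_group H"
    by (rule homI)
       (use x y z in \<open>auto simp: carrier_swap_group mult_swap_group int_pow_mult m_assoc
          yx zx zy yxg zxg zyg zz\<close>)
  moreover have "?h gen_a = x" "?h gen_b = y" "?h gen_t = z"
    using x y z by (auto simp: gen_a_def gen_b_def gen_t_def int_pow_1)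
  ultimately show ?thesis by blast
qed

end

(* The words a^i, a^i t a^j and a^i t a^j t with j nonzero are normal forms for G. They are the
   irreducible words of the string rewriting system that cancels s s^-1 and replaces t d^n t e by
   e t d^n t for n > 0 and d, e in {a, a^-1} (conjugates of a by t commute with a). Using every word
   p as left context turns it into a prefix-rewriting system. It never increases length, and it
   terminates because at equal length the letters t move to the right. A padded rule is a diagonal
   part followed by one of two simple patterns, which a deterministic automaton recognises. *)
theory Submission
  imports Defs
begin

section \<open>Words and Cayley graphs\<close>

lemma (in group) word_val_closed:
  assumes "A \<subseteq> carrier G" "w \<in> lists A"
  shows "word_val G w \<in> carrier G"
  using assms(2,1) by (induction w rule: lists.induct) (auto simp: word_val_def)

lemma (in group) word_val_append:
  assumes "A \<subseteq> carrier G" "u \<in> lists A" "v \<in> lists A"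
  shows "word_val G (u @ v) = word_val G u \<otimes> word_val G v"
  using assms(2)
proof (induction u rule: lists.induct)
  case Nil
  then show ?case using word_val_closed[OF assms(1,3)] by (simp add: word_val_def)
next
  case (Cons x u)
  then show ?case
    using word_val_closed[OF assms(1), of u] word_val_closed[OF assms(1,3)] assms(1)
    by (auto simp: word_val_def m_assoc)
qed

lemma (in group) word_val_Cons:
  "word_val G (x # u) = x \<otimes> word_val G u"
  by (simp add: word_val_def)

lemma (in group) word_val_Nil: "word_val G [] = \<one>"
  by (simp add: word_val_def)

lemma (in group) word_val_snoc:
  assumes "A \<subseteq> carrier G" "u \<in> lists A" "x \<in> A"
  shows "word_val G (u @ [x]) = word_val G u \<otimes> x"
  using word_val_append[OF assms(1,2), of "[x]"] assms by (auto simp: word_val_def)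

lemma (in group) cayley_path:
  assumes "A \<subseteq> carrier G" "w \<in> lists A" "g \<in> carrier G"
  shows "(g, g \<otimes> word_val G w) \<in> cayley_edges G A ^^ length w"
  using assms(2)
proof (induction w rule: rev_induct)
  case Nil
  then show ?case using assms(3) by (simp add: word_val_Nil)
next
  case (snoc x w)
  have "(g \<otimes> word_val G w, g \<otimes> word_val G w \<otimes> x) \<in> cayley_edges G A"
    using snoc.prems assms word_val_closed[OF assms(1), of w] by (auto simp: cayley_edges_def)
  moreover have "g \<otimes> word_val G w \<otimes> x = g \<otimes> word_val G (w @ [x])"
    using snoc.prems assms word_val_closed[OF assms(1), of w]
    by (auto simp: word_val_snoc[OF assms(1)] m_assoc)
  ultimately show ?case using snoc by auto
qed

lemma (in group) cayley_dist_word_val_le: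
  assumes "A \<subseteq> carrier G" "w \<in> lists A"
  shows "cayley_dist G A \<one> (word_val G w) \<le> length w"
  using cayley_path[OF assms, of \<one>] word_val_closed[OF assms]
  by (auto simp: cayley_dist_def intro: Least_le)

text \<open>A word for \<open>inv g \<otimes> h\<close> labels a path from \<open>g\<close> to
  \<open>h\<close>. This makes the \<open>LEAST\<close> in \<open>cayley_dist\<close> a minimum that
  is attained, so bounds valid for all paths apply to the distance.\<close>

lemma (in group) cayley_dist_path:
  assumes "A \<subseteq> carrier G" "word_val G ` lists A = carrier G" "g \<in> carrier G" "h \<in> carrier G"
  shows "(g, h) \<in> cayley_edges G A ^^ cayley_dist G A g h"
proof -
  obtain w where w: "w \<in> lists A" "word_val G w = inv g \<otimes> h"
    using assms(2-4) by (metis (no_types, lifting) imageE inv_closed m_closed)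
  have "(g, h) \<in> cayley_edges G A ^^ length w"
    using cayley_path[OF assms(1) w(1) assms(3)] w(2) assms(3,4) by (simp add: inv_solve_left m_assoc[symmetric])
  then show ?thesis unfolding cayley_dist_def by (rule LeastI)
qed


section \<open>Prefix-rewriting and regularity\<close>

lemma prefix_step_append:
  assumes "(w, w') \<in> prefix_step A R" "z \<in> lists A"
  shows "(w @ z, w' @ z) \<in> prefix_step A R"
proof -
  obtain u v y where "w = u @ y" "w' = v @ y" "(u, v) \<in> R" "y \<in> lists A"
    using assms(1) by (auto simp: prefix_step_def)
  then show ?thesis
    using assms(2) unfolding prefix_step_def mem_Collect_eq
    by (intro exI[of _ u] exI[of _ v] exI[of _ "y @ z"]) auto
qed

text \<open>Appending a suffix never blocks a prefix step. Hence irreducible words can be analysed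
  by induction, adding one letter at the right end.\<close>

lemma irreducible_word_prefix:
  assumes "irreducible_word A R (u @ v)"
  shows "irreducible_word A R u"
  using assms prefix_step_append[of u _ A R v] by (auto simp: irreducible_word_def)

lemma (in group) monoid_cong_word_val:
  assumes A: "A \<subseteq> carrier G" and R: "R \<subseteq> lists A \<times> lists A"
    and sound: "\<And>u v. (u, v) \<in> R \<Longrightarrow> word_val G u = word_val G v"
    and "(u, v) \<in> monoid_cong A R"
  shows "word_val G u = word_val G v"
  using assms(4)
proof induction
  case (rel u v x y)
  then have "u \<in> lists A" "v \<in> lists A" using R by auto
  then show ?case using rel sound by (simp add: word_val_append[OF A])
qed auto

text \<open>Well-foundedness reduces every word to an irreducible one inside its congruence class.
  Two words with equal value then reach the same irreducible word by \<open>inj\<close>, which gives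
  both completeness of the presentation and uniqueness of normal forms. Injectivity of evaluation on
  irreducible words thus takes the place of a confluence check.\<close>

lemma (in group) convergent_prefix_rewriting_systemI:
  assumes A: "A \<subseteq> carrier G" and gen: "word_val G ` lists A = carrier G"
    and R: "R \<subseteq> lists A \<times> lists A"
    and sound: "\<And>u v. (u, v) \<in> R \<Longrightarrow> word_val G u = word_val G v"
    and wf: "wf ((prefix_step A R)\<inverse>)"
    and inj: "\<And>u v. irreducible_word A R u \<Longrightarrow> irreducible_word A R v \<Longrightarrow>
                word_val G u = word_val G v \<Longrightarrow> u = v"
  shows "convergent_prefix_rewriting_system G A R"
proof -
  have step: "(w, w') \<in> monoid_cong A R \<and> w' \<in> lists A" if st: "(w, w') \<in> prefix_step A R" for w w'
  proof -
    obtain u v y where *: "w = u @ y" "w' = v @ y" "(u, v) \<in> R" "y \<in> lists A"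
      using st unfolding prefix_step_def by blast
    moreover have "v \<in> lists A" using R *(3) by blast
    ultimately show ?thesis using monoid_cong.rel[OF *(3) lists.Nil *(4)] by simp
  qed
  have nf: "\<exists>v. irreducible_word A R v \<and> (w, v) \<in> monoid_cong A R" if "w \<in> lists A" for w
    using wf that
  proof (induction w rule: wf_induct_rule)
    case (less w)
    show ?case
    proof (cases "irreducible_word A R w")
      case True
      then show ?thesis using monoid_cong.refl[OF less.prems] by blast
    next
      case False
      then obtain w' where w': "(w, w') \<in> prefix_step A R"
        using less.prems unfolding irreducible_word_def by blast
      then obtain v where v: "irreducible_word A R v" "(w', v) \<in> monoid_cong A R"
        using less.IH[of w'] step[OF w'] by blast
      have "(w, v) \<in> monoid_cong A R"
        using monoid_cong.trans[OF conjunct1[OF step[OF w']] v(2)] .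
      then show ?thesis using v(1) by blast
    qed
  qed
  have val: "word_val G u = word_val G v" if "(u, v) \<in> monoid_cong A R" for u v
    using monoid_cong_word_val[OF A R sound that] .
  have complete: "(u, v) \<in> monoid_cong A R"
    if uv: "u \<in> lists A" "v \<in> lists A" "word_val G u = word_val G v" for u v
  proof -
    obtain u' v' where u': "irreducible_word A R u'" "(u, u') \<in> monoid_cong A R"
      and v': "irreducible_word A R v'" "(v, v') \<in> monoid_cong A R"
      using nf[OF uv(1)] nf[OF uv(2)] by blast
    have "u' = v'" using inj[OF u'(1) v'(1)] val[OF u'(2)] val[OF v'(2)] uv(3) by simp
    then show ?thesis using monoid_cong.trans[OF u'(2)] monoid_cong.sym[OF v'(2)] by simp
  qed
  have "monoid_presentation G A R"
    unfolding monoid_presentation_def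
    by (intro conjI ballI iffI gen) (rule complete, assumption+, erule val)
  moreover have "\<nexists>w :: nat \<Rightarrow> 'a list. \<forall>i. (w i, w (Suc i)) \<in> prefix_step A R"
    using wf by (simp add: wf_iff_no_infinite_down_chain)
  moreover have "\<exists>!w. irreducible_word A R w \<and> word_val G w = g" if g: "g \<in> carrier G" for g
  proof -
    obtain w where w: "w \<in> lists A" "word_val G w = g"
      using g unfolding gen[symmetric] by blast
    obtain v where v: "irreducible_word A R v" "(w, v) \<in> monoid_cong A R"
      using nf[OF w(1)] by blast
    then have "irreducible_word A R v \<and> word_val G v = g" using val[OF v(2)] w(2) by simp
    then show ?thesis using inj by blast
  qed
  ultimately show ?thesis
    using R by (simp add: convergent_prefix_rewriting_system_def)
qed

text \<open>Automata may be given with states of any type: a finite state set is carried along an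
  injection \<open>f\<close> into the naturals, with \<open>g\<close> decoding states again.\<close>

lemma regular_languageI:
  fixes Q :: "'q set"
  assumes fin: "finite Q" and q0: "q0 \<in> Q" and F: "F \<subseteq> Q"
    and \<delta>: "\<And>q s. q \<in> Q \<Longrightarrow> s \<in> S \<Longrightarrow> \<delta> q s \<in> Q"
  shows "regular_language S {w \<in> lists S. foldl \<delta> q0 w \<in> F}"
proof -
  obtain f :: "'q \<Rightarrow> nat" where f: "inj_on f Q"
    using finite_imp_inj_to_nat_seg[OF fin] by blast
  define g where "g = inv_into Q f"
  have gf: "g (f q) = q" if "q \<in> Q" for q
    using that f by (simp add: g_def)
  define \<delta>' where "\<delta>' n s = f (\<delta> (g n) s)" for n s
  have run: "foldl \<delta>' (f q) w = f (foldl \<delta> q w) \<and> foldl \<delta> q w \<in> Q" if "w \<in> lists S" "q \<in> Q" for w q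
    using that by (induction w arbitrary: q rule: lists.induct) (auto simp: \<delta>'_def gf \<delta>)
  have "f q \<in> f ` F \<longleftrightarrow> q \<in> F" if "q \<in> Q" for q
    using inj_on_image_mem_iff[OF f that F] .
  then have "{w \<in> lists S. foldl \<delta> q0 w \<in> F} = {w \<in> lists S. foldl \<delta>' (f q0) w \<in> f ` F}"
    using run[OF _ q0] by (intro Collect_cong conj_cong) auto
  moreover have "\<forall>n \<in> f ` Q. \<forall>s \<in> S. \<delta>' n s \<in> f ` Q"
    by (auto simp: \<delta>'_def gf \<delta>)
  ultimately show ?thesis
    unfolding regular_language_def
    by (intro exI[of _ "f ` Q"] exI[of _ "f q0"] exI[of _ "f ` F"] exI[of _ \<delta>'] conjI)
      (use fin q0 F in auto)
qed


section \<open>A shifting string rewriting system\<close>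

text \<open>Termination and regularity are purely combinatorial, so they are proved with a map
  \<open>\<iota>\<close> in the role of inversion and a set \<open>B\<close> in the role of the
  letters a and a^-1.\<close>

locale shift_rewriting =
  fixes A B :: "'s set" and t :: 's and \<iota> :: "'s \<Rightarrow> 's"
  assumes finite_A: "finite A" and B_subset: "B \<subseteq> A" and t_in_A: "t \<in> A" and t_notin_B: "t \<notin> B"
    and \<iota>_closed: "s \<in> A \<Longrightarrow> \<iota> s \<in> A"
begin

text \<open>The block \<open>d # replicate m d\<close> is a positive power of \<open>d\<close>. It
  is split differently on the two sides so that the \<open>m\<close> inner copies of
  \<open>d\<close> stand at the same positions in both words.\<close>

inductive_set rules :: "('s list \<times> 's list) set" where
  cancel: "p \<in> lists A \<Longrightarrow> s \<in> A \<Longrightarrow> (p @ [s, \<iota> s], p) \<in> rules"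
| shift: "p \<in> lists A \<Longrightarrow> d \<in> B \<Longrightarrow> e \<in> B \<Longrightarrow>
    (p @ t # d # replicate m d @ [t, e], p @ e # t # replicate m d @ [d, t]) \<in> rules"

lemma rules_subset: "rules \<subseteq> lists A \<times> lists A"
proof -
  have "u \<in> lists A \<and> v \<in> lists A" if "(u, v) \<in> rules" for u v
    using that B_subset t_in_A by induction (auto simp: \<iota>_closed)
  then show ?thesis by auto
qed

lemma length_nonincreasing_rules: "length_nonincreasing rules"
proof -
  have "length v \<le> length u" if "(u, v) \<in> rules" for u v
    using that by induction auto
  then show ?thesis by (auto simp: length_nonincreasing_def)
qed

text \<open>Each occurrence of \<open>t\<close> contributes the length of the suffix that begins
  with it, so moving a \<open>t\<close> to the right lowers the weight.\<close>

fun t_weight :: "'s list \<Rightarrow> nat" where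
  "t_weight [] = 0"
| "t_weight (x # w) = (if x = t then Suc (length w) else 0) + t_weight w"

lemma t_weight_append:
  "t_weight (u @ v) = t_weight u + count_list u t * length v + t_weight v"
  by (induction u) (auto simp: algebra_simps)

lemma t_weight_replicate: "d \<noteq> t \<Longrightarrow> t_weight (replicate m d) = 0"
  by (induction m) auto

text \<open>Cancellation shortens the word. A shift preserves the length and moves two letters
  \<open>t\<close> one place to the right, which lowers the weight by 2 in any context.\<close>

lemma wf_prefix_step_rules: "wf ((prefix_step A rules)\<inverse>)"
proof (rule wf_subset)
  show "wf (measures [length, t_weight])" by simp
  have less: "length v < length u \<or> length v = length u \<and> t_weight (v @ w) < t_weight (u @ w)"
    if "(u, v) \<in> rules" for u v w :: "'s list"
    using that
  proof induction
    case (shift p d e m)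
    then have "d \<noteq> t" "e \<noteq> t" "count_list (replicate m d) t = 0"
      using t_notin_B by (auto intro: count_notin)
    then show ?case by (simp add: t_weight_append t_weight_replicate)
  qed auto
  show "(prefix_step A rules)\<inverse> \<subseteq> measures [length, t_weight]"
  proof clarify
    fix w' w assume "(w, w') \<in> prefix_step A rules"
    then obtain u v y where "w = u @ y" "w' = v @ y" "(u, v) \<in> rules"
      by (auto simp: prefix_step_def)
    then show "(w', w) \<in> measures [length, t_weight]"
      using less[of u v y] by auto
  qed
qed

lemma irreducible_no_rule:
  assumes "irreducible_word A rules u"
  shows "(u, v) \<notin> rules"
proof
  assume "(u, v) \<in> rules"
  then have "(u @ [], v @ []) \<in> prefix_step A rules"
    unfolding prefix_step_def by blast
  then show False using assms by (simp add: irreducible_word_def)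
qed

lemma irreducible_no_cancel: "\<not> irreducible_word A rules (p @ [s, \<iota> s])"
proof
  assume irr: "irreducible_word A rules (p @ [s, \<iota> s])"
  then have "p \<in> lists A" "s \<in> A" by (auto simp: irreducible_word_def)
  then show False using irreducible_no_rule[OF irr] rules.cancel by blast
qed

lemma irreducible_no_shift:
  assumes "d \<in> B" "e \<in> B"
  shows "\<not> irreducible_word A rules (p @ t # d # replicate m d @ [t, e])"
proof
  assume irr: "irreducible_word A rules (p @ t # d # replicate m d @ [t, e])"
  then have "p \<in> lists A" by (auto simp: irreducible_word_def)
  then show False using irreducible_no_rule[OF irr] rules.shift assms by blast
qed

end

text \<open>\<open>Start\<close> reads the common left context. \<open>Del s\<close> has seen the
  first letter of a cancellation. \<open>Mid e\<close>, \<open>Run e d\<close> and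
  \<open>End e\<close> are the stages of a shift: before the block of letters \<open>d\<close>,
  inside it, and before the final letter \<open>e\<close>.\<close>

datatype 's dfa_state = Start | Del 's | Mid 's | Run 's 's | End 's | Acc | Dead

section \<open>Recognition of the padded rules by an automaton\<close>

context shift_rewriting
begin

text \<open>The first off-diagonal letter determines the kind of rule: \<open>(s, $)\<close> starts a
  cancellation and \<open>(t, e)\<close> a shift.\<close>

fun delta :: "'s dfa_state \<Rightarrow> 's option \<times> 's option \<Rightarrow> 's dfa_state" where
  "delta Start (Some x, None) = Del x"
| "delta Start (Some x, Some y) =
     (if x = y then Start else if x = t \<and> y \<in> B then Mid y else Dead)"
| "delta (Del s) (Some x, None) = (if x = \<iota> s then Acc else Dead)"
| "delta (Mid e) (Some x, Some y) = (if x \<in> B \<and> y = t then Run e x else Dead)"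
| "delta (Run e d) (Some x, Some y) =
     (if x = d \<and> y = d then Run e d else if x = t \<and> y = d then End e else Dead)"
| "delta (End e) (Some x, Some y) = (if x = e \<and> y = t then Acc else Dead)"
| "delta _ _ = Dead"

lemma run_Dead [simp]: "foldl delta Dead w = Dead"
  by (induction w) auto

lemma run_Acc [simp]: "foldl delta Acc w = Acc \<longleftrightarrow> w = []"
  by (cases w) auto

lemma run_Del: "foldl delta (Del s) w = Acc \<longleftrightarrow> w = [(Some (\<iota> s), None)]"
proof (cases w)
  case (Cons c w')
  then show ?thesis by (cases "(Del s, c)" rule: delta.cases) auto
qed auto

lemma run_End: "foldl delta (End e) w = Acc \<longleftrightarrow> w = [(Some e, Some t)]"
proof (cases w)
  case (Cons c w')
  then show ?thesis by (cases "(End e, c)" rule: delta.cases) auto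
qed auto

text \<open>The loop letter \<open>(d, d)\<close> and the exit letter \<open>(t, d)\<close> differ
  because \<open>t\<close> is not in \<open>B\<close>. The number of turns in the loop is the
  exponent \<open>m\<close>.\<close>

lemma run_Run:
  assumes "d \<in> B"
  shows "foldl delta (Run e d) w = Acc \<longleftrightarrow>
    (\<exists>m. w = replicate m (Some d, Some d) @ [(Some t, Some d), (Some e, Some t)])"
proof
  show "foldl delta (Run e d) w = Acc \<Longrightarrow>
    \<exists>m. w = replicate m (Some d, Some d) @ [(Some t, Some d), (Some e, Some t)]"
  proof (induction w)
    case (Cons c w)
    consider "c = (Some d, Some d)" | "c = (Some t, Some d)"
      using Cons.prems by (cases "(Run e d, c)" rule: delta.cases) (auto split: if_splits)
    then show ?case
    proof cases
      case 1
      then obtain m where "w = replicate m (Some d, Some d) @ [(Some t, Some d), (Some e, Some t)]"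
        using Cons by auto
      then show ?thesis using 1 by (intro exI[of _ "Suc m"]) simp
    next
      case 2
      then show ?thesis using Cons.prems assms t_notin_B
        by (intro exI[of _ 0]) (auto simp: run_End split: if_splits)
    qed
  qed simp
next
  have "foldl delta (Run e d) (replicate m (Some d, Some d)) = Run e d" for m
    by (induction m) auto
  then show "\<exists>m. w = replicate m (Some d, Some d) @ [(Some t, Some d), (Some e, Some t)] \<Longrightarrow>
    foldl delta (Run e d) w = Acc"
    using assms t_notin_B by auto
qed

lemma run_Mid:
  "foldl delta (Mid e) w = Acc \<longleftrightarrow>
    (\<exists>d \<in> B. \<exists>m. w = (Some d, Some t) # replicate m (Some d, Some d) @ [(Some t, Some d), (Some e, Some t)])"
proof (cases w)
  case (Cons c w')
  then show ?thesis by (cases "(Mid e, c)" rule: delta.cases) (auto simp: run_Run)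
qed auto

lemma pad_Cons: "pad (x # u, y # v) = (Some x, Some y) # pad (u, v)"
  by (simp add: pad_def)

lemma pad_cancel: "pad ([s, s'], []) = [(Some s, None), (Some s', None)]"
  by (simp add: pad_def numeral_2_eq_2)

lemma pad_shift:
  "pad (t # d # replicate m d @ [t, e], e # t # replicate m d @ [d, t]) =
     (Some t, Some e) # (Some d, Some t) # replicate m (Some d, Some d) @ [(Some t, Some d), (Some e, Some t)]"
  by (induction m) (auto simp: pad_def)

lemma rules_Cons:
  assumes "(u, v) \<in> rules" "x \<in> A"
  shows "(x # u, x # v) \<in> rules"
  using assms
proof induction
  case (cancel p s)
  then show ?case using rules.cancel[of "x # p" s] by simp
next
  case (shift p d e m)
  then show ?case using rules.shift[of "x # p" d e m] by simp
qed

lemma run_pad_rule: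
  assumes "(u, v) \<in> rules"
  shows "foldl delta Start (pad (u, v)) = Acc"
proof -
  \<comment> \<open>A common left context is padded to diagonal letters, which leave the automaton
    in \<open>Start\<close>.\<close>
  have diag: "foldl delta Start (pad (p @ u, p @ v)) = foldl delta Start (pad (u, v))" for p u v
    by (induction p) (auto simp: pad_Cons)
  show ?thesis using assms
  proof cases
    case (cancel s)
    then show ?thesis using diag[of v "[s, \<iota> s]" "[]"] by (simp add: pad_cancel)
  next
    case (shift p d e m)
    then have "foldl delta (Run e d) (replicate m (Some d, Some d) @ [(Some t, Some d), (Some e, Some t)]) = Acc"
      using run_Run by blast
    \<comment> \<open>This keeps the first letter \<open>(t, e)\<close> of the shift pattern from
      being read as diagonal.\<close>
    moreover have "e \<noteq> t" using shift t_notin_B by auto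
    ultimately show ?thesis unfolding shift(1,2) diag pad_shift using shift by simp
  qed
qed

text \<open>A diagonal first letter extends the left context of a rule accepted from the rest of the
  word. Any other first letter that avoids \<open>Dead\<close> fixes the kind of rule, with empty
  left context.\<close>

lemma run_imp_pad_rule:
  fixes w :: "('s option \<times> 's option) list"
  assumes "w \<in> lists (padded_alphabet A)" "foldl delta Start w = Acc"
  shows "w \<in> pad ` rules"
  using assms
proof (induction w rule: lists.induct)
  case (Cons c w)
  obtain x y where c: "c = (x, y)" by (metis surj_pair)
  have "delta Start c \<noteq> Dead" using Cons.prems by auto
  then obtain x' where x': "x = Some x'" unfolding c by (cases x) auto
  then have "x' \<in> A" using Cons.hyps(1) c by (auto simp: padded_alphabet_def)
  then consider x where "x \<in> A" "c = (Some x, None)" | x where "x \<in> A" "c = (Some x, Some x)"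
    | e where "e \<in> B" "c = (Some t, Some e)" "e \<noteq> t"
    using \<open>delta Start c \<noteq> Dead\<close> unfolding c x' by (cases y) (auto split: if_splits)
  then show ?case
  proof cases
    case 1
    then have "c # w = pad ([x, \<iota> x], [])"
      using Cons.prems by (simp add: run_Del pad_cancel)
    then show ?thesis using rules.cancel[of "[]" x] 1 by auto
  next
    case 2
    then have "w \<in> pad ` rules" using Cons by simp
    then show ?thesis using rules_Cons[of _ _ x] 2 by (force simp: pad_Cons[symmetric])
  next
    case 3
    then have "foldl delta (Mid e) w = Acc" using Cons.prems by auto
    then obtain d m where "d \<in> B" "c # w = pad (t # d # replicate m d @ [t, e], e # t # replicate m d @ [d, t])"
      using 3 by (auto simp: run_Mid pad_shift)
    then show ?thesis using rules.shift[of "[]" d e m] 3 by force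
  qed
qed simp

lemma pad_in_lists:
  assumes "u \<in> lists A" "v \<in> lists A"
  shows "pad (u, v) \<in> lists (padded_alphabet A)"
proof -
  have "x \<in> insert None (Some ` A) \<and> y \<in> insert None (Some ` A)" if "(x, y) \<in> set (pad (u, v))" for x y
    using set_zip_leftD set_zip_rightD that assms unfolding pad_def by fastforce
  then show ?thesis by (auto simp: padded_alphabet_def)
qed

lemma synchronously_regular_rules: "synchronously_regular A rules"
proof -
  \<comment> \<open>Restricting the labels of states to the finite alphabet makes the state set
    finite.\<close>
  define Q where "Q = {Start, Acc, Dead} \<union> Del ` A \<union> Mid ` A \<union> End ` A \<union> (\<lambda>(e, d). Run e d) ` (A \<times> A)"
  have "regular_language (padded_alphabet A)
      {w \<in> lists (padded_alphabet A). foldl delta Start w \<in> {Acc}}"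
  proof (rule regular_languageI[of Q])
    fix q s assume "q \<in> Q" "s \<in> padded_alphabet A"
    then show "delta q s \<in> Q"
      using B_subset by (cases "(q, s)" rule: delta.cases) (auto simp: Q_def padded_alphabet_def)
  qed (auto simp: Q_def finite_A)
  moreover have "{w \<in> lists (padded_alphabet A). foldl delta Start w \<in> {Acc}} = pad ` rules"
  proof (intro equalityI subsetI)
    fix w assume "w \<in> pad ` rules"
    then obtain u v where "w = pad (u, v)" "(u, v) \<in> rules" by auto
    then show "w \<in> {w \<in> lists (padded_alphabet A). foldl delta Start w \<in> {Acc}}"
      using run_pad_rule pad_in_lists rules_subset by blast
  qed (use run_imp_pad_rule in auto)
  ultimately show ?thesis
    using rules_subset by (simp add: synchronously_regular_def)
qed

end

section \<open>Normal forms\<close>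

definition gen_a' :: "(int \<times> int) \<times> int" where "gen_a' = ((-1, 0), 0)"

lemma gens_eq: "swap_group_gens = {gen_a, gen_a', gen_t}"
  by (simp add: swap_group_gens_def inv_gen_a gen_a'_def)

interpretation swap: group swap_group by (rule group_swap_group)

lemma gens_subset: "swap_group_gens \<subseteq> carrier swap_group"
  by (auto simp: gens_eq carrier_swap_group gen_a_def gen_a'_def gen_t_def)

lemmas swap_word_val_append = swap.word_val_append[OF gens_subset]
  and swap_word_val_snoc = swap.word_val_snoc[OF gens_subset]
  and swap_word_val_closed = swap.word_val_closed[OF gens_subset]

definition a_pow :: "int \<Rightarrow> ((int \<times> int) \<times> int) list" where
  "a_pow m = replicate (nat \<bar>m\<bar>) (if m \<ge> 0 then gen_a else gen_a')"

text \<open>Since t a^n t = b^n, the word a^m t a^n has value ((m, n), 1) and a^m t a^n t has value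
  ((m, n), 0). For n = 0 the latter would end in the cancellable pair t t, so it is replaced by
  a^m.\<close>

fun normal_form :: "(int \<times> int) \<times> int \<Rightarrow> ((int \<times> int) \<times> int) list" where
  "normal_form ((m, n), e) =
     a_pow m @ (if e = 1 then gen_t # a_pow n else if n = 0 then [] else gen_t # a_pow n @ [gen_t])"

lemma a_pow_lists: "a_pow m \<in> lists swap_group_gens"
  by (auto simp: a_pow_def gens_eq)

lemma a_pow_0: "a_pow 0 = []"
  by (simp add: a_pow_def)

lemma word_val_replicate:
  "word_val swap_group (replicate k gen_a) = ((int k, 0), 0)"
  "word_val swap_group (replicate k gen_a') = ((- int k, 0), 0)"
  by (induction k) (simp_all add: swap.word_val_Nil swap.word_val_Cons one_swap_group
      mult_swap_group gen_a_def gen_a'_def)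

lemma word_val_a_pow: "word_val swap_group (a_pow m) = ((m, 0), 0)"
  by (simp add: a_pow_def word_val_replicate)

lemma normal_form_lists: "normal_form g \<in> lists swap_group_gens"
proof -
  have "gen_t \<in> swap_group_gens" by (simp add: gens_eq)
  then show ?thesis
    using a_pow_lists by (cases g rule: normal_form.cases) simp
qed

lemma word_val_normal_form:
  assumes "g \<in> carrier swap_group"
  shows "word_val swap_group (normal_form g) = g"
proof -
  obtain m n e where g: "g = ((m, n), e)" by (metis surj_pair)
  have t: "gen_t \<in> swap_group_gens" by (simp add: gens_eq)
  show ?thesis using assms t unfolding g
    by (auto simp: carrier_swap_group swap_word_val_append swap.word_val_Cons a_pow_lists
        word_val_a_pow swap.word_val_Nil one_swap_group gen_t_def mult_swap_group a_pow_0)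
qed

lemma word_val_surj: "word_val swap_group ` lists swap_group_gens = carrier swap_group"
proof
  show "carrier swap_group \<subseteq> word_val swap_group ` lists swap_group_gens"
    using word_val_normal_form normal_form_lists by (metis image_eqI subsetI)
qed (auto intro: swap_word_val_closed)

section \<open>Irreducible words\<close>

lemma inv_gens:
  "inv\<^bsub>swap_group\<^esub> gen_t = gen_t"
  "inv\<^bsub>swap_group\<^esub> gen_a' = gen_a"
  "inv\<^bsub>swap_group\<^esub> gen_a = gen_a'"
  by (rule swap.inv_equality;
      auto simp: gen_a_def gen_a'_def gen_t_def carrier_swap_group mult_swap_group one_swap_group)+

interpretation swap: shift_rewriting swap_group_gens "{gen_a, gen_a'}" gen_t "m_inv swap_group"
  by unfold_locales (auto simp: gens_eq inv_gens, auto simp: gen_a_def gen_a'_def gen_t_def)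

lemma rules_word_val:
  assumes "(u, v) \<in> swap.rules"
  shows "word_val swap_group u = word_val swap_group v"
  using assms
proof induction
  case (cancel p s)
  moreover have "s \<in> carrier swap_group" using cancel gens_subset by auto
  ultimately show ?case
    by (simp add: swap_word_val_append swap_word_val_closed swap.\<iota>_closed swap.word_val_Cons
        swap.word_val_Nil)
next
  case (shift p d e m)
  have [simp]: "d \<in> swap_group_gens" "e \<in> swap_group_gens" "gen_t \<in> swap_group_gens"
    using shift by (auto simp: gens_eq)
  have [simp]: "replicate m d \<in> lists swap_group_gens" by auto
  \<comment> \<open>The letters and the block lie in the first coordinate axis. Conjugation by t
    moves the block to the second axis, where it commutes with \<open>e\<close>.\<close>
  obtain i j k where "d = ((i, 0), 0)" "e = ((j, 0), 0)"
    "word_val swap_group (replicate m d) = ((k, 0), 0)"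
    using shift(2,3) word_val_replicate by (auto simp: gen_a_def gen_a'_def)
  moreover have
    "word_val swap_group (replicate m d @ [gen_t, e]) =
      word_val swap_group (replicate m d) \<otimes>\<^bsub>swap_group\<^esub> word_val swap_group [gen_t, e]"
    "word_val swap_group (replicate m d @ [d, gen_t]) =
      word_val swap_group (replicate m d) \<otimes>\<^bsub>swap_group\<^esub> word_val swap_group [d, gen_t]"
    by (simp_all add: swap_word_val_append)
  ultimately have "word_val swap_group (gen_t # d # replicate m d @ [gen_t, e]) =
      word_val swap_group (e # gen_t # replicate m d @ [d, gen_t])"
    by (simp add: swap.word_val_Cons swap.word_val_Nil one_swap_group gen_t_def mult_swap_group)
  then show ?case using shift(1) by (simp add: swap_word_val_append)
qed

section \<open>Irreducible words are normal forms\<close>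

lemma a_pow_snoc:
  "m \<ge> 0 \<Longrightarrow> a_pow m @ [gen_a] = a_pow (m + 1)"
  "m \<le> 0 \<Longrightarrow> a_pow m @ [gen_a'] = a_pow (m - 1)"
proof -
  have "nat \<bar>m + 1\<bar> = Suc (nat \<bar>m\<bar>)" if "m \<ge> 0" using that by simp
  then show "m \<ge> 0 \<Longrightarrow> a_pow m @ [gen_a] = a_pow (m + 1)"
    by (simp add: a_pow_def replicate_append_same)
  have "nat \<bar>m - 1\<bar> = Suc (nat \<bar>m\<bar>)" if "m \<le> 0" using that by simp
  \<comment> \<open>The case m = 0 is separate because the repeated letter in \<open>a_pow\<close>
    changes there from \<open>gen_a\<close> to \<open>gen_a'\<close>.\<close>
  then show "m \<le> 0 \<Longrightarrow> a_pow m @ [gen_a'] = a_pow (m - 1)"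
    by (cases "m = 0") (simp_all add: a_pow_def replicate_append_same)
qed

lemma a_pow_Cons:
  assumes "m \<noteq> 0"
  obtains d k where "d \<in> {gen_a, gen_a'}" "a_pow m = d # replicate k d"
proof -
  obtain k where "nat \<bar>m\<bar> = Suc k" using assms by (cases "nat \<bar>m\<bar>") auto
  then show ?thesis using that by (auto simp: a_pow_def split: if_splits)
qed

text \<open>If the sign of \<open>e\<close> were opposite to that of a nonzero \<open>m\<close>,
  then \<open>e\<close> would cancel with the last letter of the power. The number
  \<open>fst (fst e)\<close> is the exponent 1 or -1 of \<open>e\<close>.\<close>

lemma irreducible_a_pow_snoc:
  assumes irr: "irreducible_word swap_group_gens swap.rules (p @ a_pow m @ [e])" and e: "e \<in> {gen_a, gen_a'}"
  shows "a_pow m @ [e] = a_pow (m + fst (fst e))"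
proof -
  consider "e = gen_a" "m \<ge> 0" | "e = gen_a" "m < 0" | "e = gen_a'" "m \<le> 0" | "e = gen_a'" "m > 0"
    using e by fastforce
  then show ?thesis
  proof cases
    case 2
    then have "a_pow m = a_pow (m + 1) @ [gen_a']" using a_pow_snoc(2)[of "m + 1"] by simp
    then show ?thesis
      using irr swap.irreducible_no_cancel[of "p @ a_pow (m + 1)" gen_a'] 2 by (simp add: inv_gens)
  next
    case 4
    then have "a_pow m = a_pow (m - 1) @ [gen_a]" using a_pow_snoc(1)[of "m - 1"] by simp
    then show ?thesis
      using irr swap.irreducible_no_cancel[of "p @ a_pow (m - 1)" gen_a] 4 by (simp add: inv_gens)
  qed (use a_pow_snoc in \<open>auto simp: gen_a_def gen_a'_def\<close>)
qed

text \<open>By induction the word without its last letter is a normal form. Appending a letter to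
  each of the three shapes either gives a normal form again or completes the left side of a
  rule.\<close>

lemma irreducible_normal_form:
  assumes "irreducible_word swap_group_gens swap.rules w"
  shows "normal_form (word_val swap_group w) = w"
  using assms
proof (induction w rule: rev_induct)
  case Nil
  then show ?case by (simp add: swap.word_val_Nil one_swap_group a_pow_0)
next
  case (snoc x w)
  have w: "w \<in> lists swap_group_gens" and x: "x \<in> swap_group_gens"
    using snoc.prems by (auto simp: irreducible_word_def)
  obtain m n e where g: "word_val swap_group w = ((m, n), e)" by (metis surj_pair)
  have e: "e = 0 \<or> e = 1" using swap_word_val_closed[OF w] g by (simp add: carrier_swap_group)
  have nf: "w = normal_form ((m, n), e)"
    using snoc irreducible_word_prefix g by metis
  have val: "word_val swap_group (w @ [x]) = ((m, n), e) \<otimes>\<^bsub>swap_group\<^esub> x"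
    using swap_word_val_snoc[OF w x] g by simp
  note irr = snoc.prems
  consider "e = 0" "n = 0" | "e = 0" "n \<noteq> 0" | "e = 1" using e by blast
  then show ?case
  proof cases
    case 1
    then have w: "w = a_pow m" using nf by simp
    show ?thesis
    proof (cases "x = gen_t")
      case True
      then show ?thesis unfolding val using 1 w by (simp add: gen_t_def mult_swap_group a_pow_0)
    next
      case False
      then have "x \<in> {gen_a, gen_a'}" using x by (auto simp: gens_eq)
      then show ?thesis unfolding val
        using irreducible_a_pow_snoc[of "[]" m x] irr 1 w by (auto simp: gen_a_def gen_a'_def mult_swap_group)
    qed
  next
    case 2
    then have w: "w = a_pow m @ gen_t # a_pow n @ [gen_t]" using nf by simp
    obtain d k where d: "d \<in> {gen_a, gen_a'}" "a_pow n = d # replicate k d"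
      using a_pow_Cons[OF 2(2)] .
    \<comment> \<open>Nothing can follow the shape a^m t a^n t with n nonzero: a further t cancels,
      and a or a^-1 triggers a shift.\<close>
    have False
    proof (cases "x = gen_t")
      case True
      then show False
        using swap.irreducible_no_cancel[of "a_pow m @ gen_t # a_pow n" gen_t] irr
        by (simp add: w inv_gens)
    next
      case False
      then have "x \<in> {gen_a, gen_a'}" using x by (auto simp: gens_eq)
      then show False
        using swap.irreducible_no_shift[of d x "a_pow m" k] irr d by (simp add: w)
    qed
    then show ?thesis ..
  next
    case 3
    then have w: "w = a_pow m @ gen_t # a_pow n" using nf by simp
    show ?thesis
    proof (cases "x = gen_t")
      case True
      have "n \<noteq> 0"
        using swap.irreducible_no_cancel[of "a_pow m" gen_t] irr True
        by (auto simp: w inv_gens a_pow_0)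
      then show ?thesis unfolding val using 3 w True by (simp add: gen_t_def mult_swap_group)
    next
      case False
      then have "x \<in> {gen_a, gen_a'}" using x by (auto simp: gens_eq)
      then show ?thesis unfolding val
        using irreducible_a_pow_snoc[of "a_pow m @ [gen_t]" n x] irr 3 w
        by (auto simp: gen_a_def gen_a'_def mult_swap_group)
    qed
  qed
qed

lemma convergent_rules: "convergent_prefix_rewriting_system swap_group swap_group_gens swap.rules"
proof (rule swap.convergent_prefix_rewriting_systemI[OF gens_subset word_val_surj swap.rules_subset
      rules_word_val swap.wf_prefix_step_rules])
  fix u v
  assume "irreducible_word swap_group_gens swap.rules u" "irreducible_word swap_group_gens swap.rules v"
    "word_val swap_group u = word_val swap_group v"
  then show "u = v" using irreducible_normal_form by metis
qed


section \<open>Failure of the falsification by fellow traveler property\<close>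

text \<open>An edge labelled a or a^-1 changes one coordinate by one and an edge labelled t changes
  neither, so projection to Z^2 with the l1 metric does not increase distance.\<close>

lemma cayley_path_coordinates:
  assumes "(((m, n), e), ((m', n'), e')) \<in> cayley_edges swap_group swap_group_gens ^^ k"
  shows "\<bar>m' - m\<bar> + \<bar>n' - n\<bar> \<le> int k"
  using assms
proof (induction k arbitrary: m' n' e')
  case (Suc k)
  then obtain p q f where path: "(((m, n), e), ((p, q), f)) \<in> cayley_edges swap_group swap_group_gens ^^ k"
    and "(((p, q), f), ((m', n'), e')) \<in> cayley_edges swap_group swap_group_gens"
    by auto
  then have "\<bar>m' - p\<bar> + \<bar>n' - q\<bar> \<le> 1"
    by (auto simp: cayley_edges_def gens_eq gen_a_def gen_a'_def gen_t_def mult_swap_group split: if_splits)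
  then show ?case using Suc.IH[OF path] by simp
qed simp

lemma cayley_dist_coordinates:
  assumes "((m, n), e) \<in> carrier swap_group" "((m', n'), e') \<in> carrier swap_group"
  shows "\<bar>m' - m\<bar> + \<bar>n' - n\<bar> \<le> int (cayley_dist swap_group swap_group_gens ((m, n), e) ((m', n'), e'))"
  by (rule cayley_path_coordinates[OF swap.cayley_dist_path[OF gens_subset word_val_surj assms]])

text \<open>Only letters other than t can move the coordinates, each by one, so every t is spent
  length. Each t flips the last component, which therefore records the parity of their
  number.\<close>

lemma word_val_bound:
  assumes "w \<in> lists swap_group_gens" "word_val swap_group w = ((m, n), e)"
  shows "\<bar>m\<bar> + \<bar>n\<bar> + int (count_list w gen_t) \<le> int (length w) \<and> e = int (count_list w gen_t) mod 2"
  using assms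
proof (induction w arbitrary: m n e rule: rev_induct)
  case Nil
  then show ?case by (simp add: swap.word_val_Nil one_swap_group)
next
  case (snoc x w)
  obtain p q f where val: "word_val swap_group w = ((p, q), f)" by (metis surj_pair)
  have IH: "\<bar>p\<bar> + \<bar>q\<bar> + int (count_list w gen_t) \<le> int (length w)" "f = int (count_list w gen_t) mod 2"
    using snoc val by auto
  have x: "x \<in> swap_group_gens" using snoc.prems by simp
  have prod: "((m, n), e) = ((p, q), f) \<otimes>\<^bsub>swap_group\<^esub> x"
    using snoc.prems val swap_word_val_snoc by simp
  have f: "f = 0 \<or> f = 1" using IH(2) by presburger
  consider "x = gen_a" | "x = gen_a'" | "x = gen_t" using x by (auto simp: gens_eq)
  then have "x \<noteq> gen_t \<and> \<bar>m\<bar> + \<bar>n\<bar> \<le> \<bar>p\<bar> + \<bar>q\<bar> + 1 \<and> e = f mod 2 \<or>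
      x = gen_t \<and> m = p \<and> n = q \<and> e = (f + 1) mod 2"
    using prod f by cases (auto simp: gen_a_def gen_a'_def gen_t_def mult_swap_group split: if_splits)
  then show ?case using IH by (auto simp: mod_simps add.commute)
qed

section \<open>Words with at most one t\<close>

lemma word_val_no_t:
  assumes "w \<in> lists swap_group_gens" "gen_t \<notin> set w"
  obtains m where "word_val swap_group w = ((m, 0), 0)"
proof -
  have "\<exists>m. word_val swap_group w = ((m, 0), 0)"
    using assms
  proof (induction w rule: lists.induct)
    case (Cons x w)
    then show ?case
      by (auto simp: swap.word_val_Cons gens_eq gen_a_def gen_a'_def mult_swap_group)
  qed (simp add: swap.word_val_Nil one_swap_group)
  then show thesis using that by blast
qed

text \<open>The length leaves room for at most two letters t, and parity forces exactly one. All of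
  the first coordinate \<open>k\<close> must then be produced before that t, so the first
  \<open>k\<close> letters contain no t and stay on the first axis.\<close>

lemma one_t_prefix:
  assumes v: "v \<in> lists swap_group_gens" and val: "word_val swap_group v = ((int k, int l), 1)"
    and len: "length v \<le> k + l + 2"
  obtains m where "word_val swap_group (take k v) = ((m, 0), 0)"
proof -
  have "int (count_list v gen_t) \<le> 2" "int (count_list v gen_t) mod 2 = 1"
    using word_val_bound[OF v val] len by auto
  then have c: "count_list v gen_t = 1" by (cases "count_list v gen_t = 2") auto
  then have "gen_t \<in> set v" by (metis count_notin zero_neq_one)
  then obtain x y where xy: "v = x @ gen_t # y" by (meson split_list)
  then have no_t: "gen_t \<notin> set x" "gen_t \<notin> set y" using c by (auto simp: count_list_0_iff)
  have lists: "x \<in> lists swap_group_gens" "y \<in> lists swap_group_gens" "gen_t \<in> swap_group_gens"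
    using v xy by auto
  obtain p where p: "word_val swap_group x = ((p, 0), 0)" using word_val_no_t lists no_t by metis
  obtain q where q: "word_val swap_group y = ((q, 0), 0)" using word_val_no_t lists no_t by metis
  have "p = int k"
    using val lists p q
    by (simp add: xy swap_word_val_append swap.word_val_Cons mult_swap_group gen_t_def)
  then have "k \<le> length x" using word_val_bound[OF lists(1) p] by simp
  then have "take k v = take k x" by (simp add: xy)
  moreover have "take k x \<in> lists swap_group_gens" "gen_t \<notin> set (take k x)"
    using lists no_t by (auto dest: in_set_takeD)
  ultimately show thesis using word_val_no_t that by metis
qed

text \<open>The word \<open>u = a\<^sup>n t a\<^sup>n t a\<^sup>n t a\<^sup>n\<close> passes near \<open>(n, n)\<close>, whereas every shorter word with the
  same value has a single \<open>t\<close> and therefore passes through \<open>(2n, 0)\<close>.\<close>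

lemma not_falsification_by_fellow_traveler:
  "\<not> falsification_by_fellow_traveler swap_group swap_group_gens"
proof
  assume "falsification_by_fellow_traveler swap_group swap_group_gens"
  then obtain k where k: "\<forall>u \<in> lists swap_group_gens. \<not> geodesic_word swap_group swap_group_gens u \<longrightarrow>
      (\<exists>v \<in> lists swap_group_gens. length v < length u \<and> word_val swap_group u = word_val swap_group v \<and>
        (\<forall>n. cayley_dist swap_group swap_group_gens
           (word_val swap_group (take n u)) (word_val swap_group (take n v)) \<le> k))"
    unfolding falsification_by_fellow_traveler_def ..
  \<comment> \<open>At time 2n the second coordinates along the two words will be n - 1 and 0, and n
    - 1 = k + 1 exceeds the assumed bound.\<close>
  define n where "n = k + 2"
  define as where "as j = replicate j gen_a" for j
  define u where "u = as n @ gen_t # as n @ gen_t # as n @ gen_t # as n"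
  have as: "as j \<in> lists swap_group_gens" "word_val swap_group (as j) = ((int j, 0), 0)"
    "length (as j) = j" for j
    by (auto simp: as_def gens_eq word_val_replicate)
  have t: "gen_t \<in> swap_group_gens" by (simp add: gens_eq)
  note val_simps = swap_word_val_append swap.word_val_Cons mult_swap_group gen_t_def
  have u: "u \<in> lists swap_group_gens" "length u = 4 * n + 3"
    using as t by (auto simp: u_def)
  have val_u: "word_val swap_group u = ((int (2 * n), int (2 * n)), 1)"
    using as t by (simp add: u_def val_simps)
  \<comment> \<open>This word has length 4n + 1, two less than \<open>u\<close>, and so witnesses
    that \<open>u\<close> is not geodesic.\<close>
  let ?g = "as (2 * n) @ gen_t # as (2 * n)"
  have g: "?g \<in> lists swap_group_gens" "word_val swap_group ?g = word_val swap_group u"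
    using as t val_u by (auto simp: val_simps)
  have "\<not> geodesic_word swap_group swap_group_gens u"
    using swap.cayley_dist_word_val_le[OF gens_subset g(1)] g(2) u(2) as(3)
    by (simp add: geodesic_word_def)
  then obtain v where v: "v \<in> lists swap_group_gens" "length v < length u"
    "word_val swap_group v = ((int (2 * n), int (2 * n)), 1)"
    and near: "cayley_dist swap_group swap_group_gens
      (word_val swap_group (take (2 * n) u)) (word_val swap_group (take (2 * n) v)) \<le> k"
    using bspec[OF k u(1)] val_u by metis
  \<comment> \<open>Being shorter than \<open>u\<close>, the word \<open>v\<close> has length at
    most 4n + 2 = 2n + 2n + 2, the most that \<open>one_t_prefix\<close> allows.\<close>
  obtain m where m: "word_val swap_group (take (2 * n) v) = ((m, 0), 0)"
    using one_t_prefix[OF v(1,3)] v(2) u(2) by auto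
  \<comment> \<open>One of the 2n letters is the t, which leaves n - 1 letters a after it.\<close>
  have "take (2 * n) u = as n @ gen_t # as (n - 1)"
  proof -
    have "2 * n = n + Suc (n - 1)" by (simp add: n_def)
    moreover have "take (n + Suc (n - 1)) u = as n @ gen_t # as (n - 1)"
      unfolding u_def as_def by (simp add: min_def)
    ultimately show ?thesis by metis
  qed
  then have "word_val swap_group (take (2 * n) u) = ((int n, int (n - 1)), 1)"
    using as t by (simp add: val_simps)
  then have "\<bar>m - int n\<bar> + \<bar>0 - int (n - 1)\<bar> \<le> int k"
    using cayley_dist_coordinates[of "int n" "int (n - 1)" 1 m 0 0] near m
    by (simp add: carrier_swap_group)
  then show False by (simp add: n_def)
qed

theorem theoremE:
  shows "(\<exists>R. convergent_prefix_rewriting_system swap_group swap_group_gens R \<and>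
              synchronously_regular swap_group_gens R \<and> length_nonincreasing R) \<and>
         \<not> falsification_by_fellow_traveler swap_group swap_group_gens"
  by (intro conjI exI[of _ swap.rules] convergent_rules swap.synchronously_regular_rules
      swap.length_nonincreasing_rules not_falsification_by_fellow_traveler)

end
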